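(* Let $H_1,H_2$ be complex Hilbert spaces. If $A = \alpha W + K$, where $\alpha \geq 0$, $W \in \mathcal{AN}(H_1,H_2)$ is a partial isometry and $K \in \mathcal{K}(H_1,H_2)$ is a compact operator, then $A \in \overline{\mathcal{AN}(H_1,H_2)}$.
   Context: Hilbert spaces are complex, of arbitrary dimension. $\mathcal{B}(H_1,H_2)$ is the space of bounded linear operators with the operator norm, and $\mathcal{K}(H_1,H_2)$ is the set of compact operators. $T\in\mathcal{B}(H_1,H_2)$ is norm attaining if there is $x\in H_1$ with $\|x\|=1$ and $\|Tx\|=\|T\|$. $T$ is absolutely norm attaining (an $\mathcal{AN}$-operator) if for every nonzero closed subspace $M$ of $H_1$ the restriction $T|_M:M\to H_2$ is norm attaining. $\mathcal{AN}(H_1,H_2)$ is the set of $\mathcal{AN}$-operators, and $\overline{\mathcal{A}}$ denotes the closure of $\mathcal{A}\subseteq\mathcal{B}(H_1,H_2)$ in the operator norm. $W\in\mathcal{B}(H_1,H_2)$ is a partial isometry if $\|Wx\|=\|x\|$ for all $x\in N(W)^\perp$, where $N(W)$ is the null space of $W$. *)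

theory Defs
  imports "HOL-Analysis.Analysis"
begin

class complex_vector = real_vector +
  fixes scaleC :: "complex \<Rightarrow> 'a \<Rightarrow> 'a"  (infixr "*\<^sub>C" 75)
  assumes scaleC_add_right: "a *\<^sub>C (x + y) = a *\<^sub>C x + a *\<^sub>C y"
    and scaleC_add_left: "(a + b) *\<^sub>C x = a *\<^sub>C x + b *\<^sub>C x"
    and scaleC_scaleC: "a *\<^sub>C b *\<^sub>C x = (a * b) *\<^sub>C x"
    and scaleC_one: "1 *\<^sub>C x = x"
    and scaleR_scaleC: "r *\<^sub>R x = complex_of_real r *\<^sub>C x"

global_interpretation complex_vector: vector_space "scaleC :: complex \<Rightarrow> 'a \<Rightarrow> 'a::complex_vector"
  by unfold_locales (simp_all add: scaleC_add_right scaleC_add_left scaleC_scaleC scaleC_one)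

text \<open>
  The inner product is linear in its first argument. Its real part is the inner product of the
  underlying real space, so the norm, the metric and the positive definiteness of \<open>cinner\<close> are
  those of \<^class>\<open>real_inner\<close>; see \<open>norm_eq_sqrt_cinner\<close> and \<open>cinner_self\<close> below.
\<close>

class complex_inner = complex_vector + real_inner +
  fixes cinner :: "'a \<Rightarrow> 'a \<Rightarrow> complex"
  assumes cinner_commute: "cinner x y = cnj (cinner y x)"
    and cinner_add_left: "cinner (x + y) z = cinner x z + cinner y z"
    and cinner_scaleC_left: "cinner (c *\<^sub>C x) y = c * cinner x y"
    and inner_eq_Re_cinner: "inner x y = Re (cinner x y)"

class chilbert_space = complex_inner + complete_space

lemma norm_eq_sqrt_cinner: "norm x = sqrt (Re (cinner x x))"
  for x :: "'a::complex_inner"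
  by (simp add: norm_eq_sqrt_inner inner_eq_Re_cinner)

lemma cinner_self: "cinner x x = complex_of_real ((norm x)\<^sup>2)"
  for x :: "'a::complex_inner"
proof (rule complex_eqI)
  show "Re (cinner x x) = Re (complex_of_real ((norm x)\<^sup>2))"
    by (simp add: power2_norm_eq_inner inner_eq_Re_cinner del: of_real_power)
  have "Im (cinner x x) = Im (cnj (cinner x x))"
    by (subst cinner_commute) simp
  then show "Im (cinner x x) = Im (complex_of_real ((norm x)\<^sup>2))"
    by (simp del: of_real_power)
qed

instantiation complex :: chilbert_space
begin

definition scaleC_complex :: "complex \<Rightarrow> complex \<Rightarrow> complex"
  where "scaleC_complex c x = c * x"

definition cinner_complex :: "complex \<Rightarrow> complex \<Rightarrow> complex"
  where "cinner_complex x y = x * cnj y"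

instance
  by standard
    (simp_all add: scaleC_complex_def cinner_complex_def inner_complex_def scaleR_conv_of_real
      algebra_simps)

end

definition orthogonal_complement :: "'a::complex_inner set \<Rightarrow> 'a set"
  where "orthogonal_complement S = {x. \<forall>y\<in>S. cinner x y = 0}"

text \<open>
  \<^typ>\<open>'a \<Rightarrow>\<^sub>L 'b\<close> consists of the bounded real-linear maps, with the operator norm. The bounded
  complex-linear ones form a closed subset, so the closure of a set of bounded operators taken in
  \<^typ>\<open>'a \<Rightarrow>\<^sub>L 'b\<close> is its closure in the space of bounded operators.
\<close>

definition bounded_operators :: "('a::complex_inner \<Rightarrow>\<^sub>L 'b::complex_inner) set"
  where "bounded_operators = {T. Vector_Spaces.linear scaleC scaleC (blinfun_apply T)}"

lemma closed_bounded_operators: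
  "closed (bounded_operators :: ('a::complex_inner \<Rightarrow>\<^sub>L 'b::complex_inner) set)"
proof -
  have lin: "Vector_Spaces.linear scaleC scaleC (blinfun_apply T) \<longleftrightarrow>
      (\<forall>c x. blinfun_apply T (c *\<^sub>C x) = c *\<^sub>C blinfun_apply T x)"
    for T :: "'a \<Rightarrow>\<^sub>L 'b"
    by (auto simp: Vector_Spaces.linear_iff blinfun.add_right
        complex_vector.vector_space_axioms)
  have norm_scaleC: "norm (c *\<^sub>C y) = norm c * norm y" for c and y :: 'b
  proof -
    have "cinner (c *\<^sub>C y) (c *\<^sub>C y) = c * cnj c * cinner y y"
      by (metis cinner_commute cinner_scaleC_left complex_cnj_mult mult.assoc mult.left_commute)
    then have "complex_of_real ((norm (c *\<^sub>C y))\<^sup>2) = complex_of_real ((norm c * norm y)\<^sup>2)"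
      by (simp only: cinner_self complex_norm_square[symmetric] power_mult_distrib of_real_mult)
    then have "(norm (c *\<^sub>C y))\<^sup>2 = (norm c * norm y)\<^sup>2"
      by (simp only: of_real_eq_iff)
    then show ?thesis
      by (simp add: power2_eq_iff_nonneg)
  qed
  have "bounded_linear (\<lambda>y::'b. c *\<^sub>C y)" for c
    by (rule bounded_linear_intro[where K = "norm c"])
      (simp_all add: scaleC_add_right scaleR_scaleC scaleC_scaleC norm_scaleC mult.commute)
  then have cont: "continuous_on UNIV (\<lambda>T::'a \<Rightarrow>\<^sub>L 'b. c *\<^sub>C blinfun_apply T x)" for c x
    by (intro bounded_linear.continuous_on[where f = "scaleC c"] continuous_intros) auto
  have "bounded_operators =
      (\<Inter>c. \<Inter>x. {T::'a \<Rightarrow>\<^sub>L 'b. blinfun_apply T (c *\<^sub>C x) = c *\<^sub>C blinfun_apply T x})"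
    by (auto simp: bounded_operators_def lin)
  also have "closed \<dots>"
    by (intro closed_INT ballI closed_Collect_eq cont continuous_intros)
  finally show ?thesis .
qed

definition compact_operators :: "('a::complex_inner \<Rightarrow>\<^sub>L 'b::complex_inner) set"
  where "compact_operators =
    {T \<in> bounded_operators. \<forall>S. bounded S \<longrightarrow> compact (closure (blinfun_apply T ` S))}"

text \<open>
  The operator norm of the restriction of \<open>T\<close> to the subspace \<open>M\<close>; the quotient is \<open>0\<close> at \<open>x = 0\<close>,
  as in the definition of \<^const>\<open>onorm\<close>.
\<close>

definition norm_on :: "'a::complex_inner set \<Rightarrow> ('a \<Rightarrow>\<^sub>L 'b::complex_inner) \<Rightarrow> real"
  where "norm_on M T = (SUP x\<in>M. norm (blinfun_apply T x) / norm x)"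

lemma norm_on_UNIV: "norm_on UNIV T = norm T"
  by (simp add: norm_on_def norm_blinfun.rep_eq onorm_def)

definition norm_attaining_on :: "'a::complex_inner set \<Rightarrow> ('a \<Rightarrow>\<^sub>L 'b::complex_inner) \<Rightarrow> bool"
  where "norm_attaining_on M T \<longleftrightarrow>
    (\<exists>x\<in>M. norm x = 1 \<and> norm (blinfun_apply T x) = norm_on M T)"

definition AN_operators :: "('a::complex_inner \<Rightarrow>\<^sub>L 'b::complex_inner) set"
  where "AN_operators = {T \<in> bounded_operators.
    \<forall>M. complex_vector.subspace M \<and> closed M \<and> M \<noteq> {0} \<longrightarrow> norm_attaining_on M T}"

definition null_space :: "('a::complex_inner \<Rightarrow>\<^sub>L 'b::complex_inner) \<Rightarrow> 'a set"
  where "null_space T = {x. blinfun_apply T x = 0}"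

definition partial_isometry :: "('a::complex_inner \<Rightarrow>\<^sub>L 'b::complex_inner) \<Rightarrow> bool"
  where "partial_isometry W \<longleftrightarrow> W \<in> bounded_operators \<and>
    (\<forall>x\<in>orthogonal_complement (null_space W). norm (blinfun_apply W x) = norm x)"

end

theory Submission
  imports Defs
begin

text \<open>
  Covering the image of the unit ball under \<open>K\<close> by finitely many balls centred at the points of
  a finite set \<open>Y\<close>, and projecting onto the double orthogonal complement of \<open>Y\<close>, approximates
  \<open>K\<close> by a finite-rank operator \<open>F\<close>. It then suffices that \<open>\<alpha> W + F\<close> is absolutely norm
  attaining. Since \<open>W\<close> is absolutely norm attaining, its null space or the orthogonal complement
  of its null space is finite-dimensional. Hence on a closed subspace of finite codimension \<open>F\<close>
  vanishes and \<open>\<alpha> W + F\<close> is a multiple of an isometry, respectively zero; cutting this subspace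
  down further, its image becomes orthogonal to the image of its complement. Norm attainment is
  thereby reduced to a finite-dimensional space.
\<close>

section \<open>Orthogonal projections\<close>

text \<open>A minimizing sequence for the distance from \<open>x\<close> to \<open>U\<close> is
  Cauchy by the parallelogram law, and its limit is the foot of the perpendicular. Real subspaces
  are treated because the criterion below applies this to a subspace that is only known to be
  real.\<close>

lemma orthogonal_decomposition:
  fixes U :: "'a::{real_inner,complete_space} set"
  assumes U: "subspace U" "closed U"
  obtains u where "u \<in> U" "\<And>v. v \<in> U \<Longrightarrow> inner (x - u) v = 0"
proof -
  define d where "d = (INF u\<in>U. (norm (x - u))\<^sup>2)"
  have ne: "U \<noteq> {}" using subspace_0[OF U(1)] by blast
  have bdd: "bdd_below ((\<lambda>u. (norm (x - u))\<^sup>2) ` U)"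
    by (rule bdd_belowI2[of _ 0]) simp
  have dle: "d \<le> (norm (x - u))\<^sup>2" if "u \<in> U" for u
    unfolding d_def by (rule cINF_lower[OF bdd that])
  have "\<exists>u. u \<in> U \<and> (norm (x - u))\<^sup>2 < d + inverse (real (Suc n))" for n
  proof -
    have "d < d + inverse (real (Suc n))" by simp
    then show ?thesis unfolding d_def cINF_less_iff[OF ne bdd] by blast
  qed
  then have "\<exists>u. \<forall>n. u n \<in> U \<and> (norm (x - u n))\<^sup>2 < d + inverse (real (Suc n))"
    by (intro choice allI)
  then obtain u where u: "\<And>n. u n \<in> U"
    and ud: "\<And>n. (norm (x - u n))\<^sup>2 < d + inverse (real (Suc n))"
    by blast
  have dist: "(norm (u m - u n))\<^sup>2 \<le> 2 * inverse (real (Suc m)) + 2 * inverse (real (Suc n))" for m n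
  proof -
    \<comment> \<open>The midpoint of two near-minimizers is at squared distance at least
      \<open>d\<close>; the parallelogram law turns this into closeness of the two points.\<close>
    have "(1/2) *\<^sub>R (u m + u n) \<in> U"
      using U(1) u by (simp add: subspace_add subspace_scale)
    then have "d \<le> (norm (x - (1/2) *\<^sub>R (u m + u n)))\<^sup>2" by (rule dle)
    moreover have "(norm (u m - u n))\<^sup>2 =
        2 * (norm (x - u m))\<^sup>2 + 2 * (norm (x - u n))\<^sup>2 - 4 * (norm (x - (1/2) *\<^sub>R (u m + u n)))\<^sup>2"
      by (simp add: power2_norm_eq_inner inner_diff_left inner_diff_right inner_add_left
          inner_add_right inner_commute algebra_simps)
    ultimately show ?thesis using ud[of m] ud[of n] by linarith
  qed
  have "Cauchy u"
  proof (rule CauchyI)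
    fix e :: real assume e: "e > 0"
    obtain n0 where n0: "inverse (real (Suc n0)) < e\<^sup>2 / 4"
      using reals_Archimedean[of "e\<^sup>2 / 4"] e by auto
    have "norm (u m - u n) < e" if "m \<ge> n0" "n \<ge> n0" for m n
    proof -
      have "inverse (real (Suc m)) \<le> inverse (real (Suc n0))"
        "inverse (real (Suc n)) \<le> inverse (real (Suc n0))"
        using that by (auto intro!: le_imp_inverse_le)
      then have "(norm (u m - u n))\<^sup>2 < e\<^sup>2" using dist[of m n] n0 by linarith
      then show ?thesis using e by (intro power2_less_imp_less[of _ e]) auto
    qed
    then show "\<exists>M. \<forall>m\<ge>M. \<forall>n\<ge>M. norm (u m - u n) < e" by blast
  qed
  then obtain w where w: "u \<longlonglongrightarrow> w" using Cauchy_convergent convergent_def by blast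
  have wU: "w \<in> U" using closed_sequentially[OF U(2)] u w by blast
  have "(norm (x - w))\<^sup>2 \<le> d"
  proof (rule LIMSEQ_le)
    show "(\<lambda>n. (norm (x - u n))\<^sup>2) \<longlonglongrightarrow> (norm (x - w))\<^sup>2"
      using w by (intro tendsto_intros)
    show "(\<lambda>n. d + inverse (real (Suc n))) \<longlonglongrightarrow> d"
      using tendsto_add[OF tendsto_const LIMSEQ_inverse_real_of_nat, of d] by simp
    show "\<exists>N. \<forall>n\<ge>N. (norm (x - u n))\<^sup>2 \<le> d + inverse (real (Suc n))"
      using ud less_imp_le by blast
  qed
  then have min: "(norm (x - w))\<^sup>2 \<le> (norm (x - v))\<^sup>2" if "v \<in> U" for v
    using dle[OF that] by linarith
  have "inner (x - w) v = 0" if v: "v \<in> U" for v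
  proof (cases "v = 0")
    case False
    \<comment> \<open>The minimizer of the quadratic
      \<open>s \<mapsto> (norm (x - w - s *\<^sub>R v))\<^sup>2\<close>; minimality of
      \<open>w\<close> forces its gain to vanish.\<close>
    define t where "t = inner (x - w) v / inner v v"
    have pos: "inner v v > 0" using False by simp
    have "w + t *\<^sub>R v \<in> U" using U(1) wU v by (simp add: subspace_add subspace_scale)
    from min[OF this]
    have "inner (x - w) (x - w) \<le> inner (x - w - t *\<^sub>R v) (x - w - t *\<^sub>R v)"
      by (simp add: power2_norm_eq_inner diff_diff_eq)
    also have "\<dots> = inner (x - w) (x - w) - 2 * t * inner (x - w) v + t * (t * inner v v)"
      by (simp add: inner_diff_left inner_diff_right inner_commute algebra_simps)
    also have "t * inner v v = inner (x - w) v" using pos by (simp add: t_def)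
    finally have "t * inner (x - w) v \<le> 0" by simp
    then have "(inner (x - w) v)\<^sup>2 \<le> 0"
      using pos by (simp add: t_def power2_eq_square divide_le_0_iff)
    then show ?thesis by simp
  qed simp
  with wU show ?thesis by (rule that)
qed

section \<open>Orthogonal complements through the real inner product\<close>

text \<open>The imaginary part of \<open>cinner x y\<close> is the real inner product of
  \<open>x\<close> with \<open>\<i> *\<^sub>C y\<close>.\<close>

lemma cinner_eq_0_iff_inner:
  "cinner x y = 0 \<longleftrightarrow> inner x y = 0 \<and> inner x (\<i> *\<^sub>C y) = 0" for x y :: "'a::complex_inner"
proof -
  have "cinner x (\<i> *\<^sub>C y) = cnj (\<i> * cinner y x)"
    by (metis cinner_commute cinner_scaleC_left)
  also have "\<dots> = - \<i> * cinner x y"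
    by (metis cinner_commute complex_cnj_mult complex_cnj_i)
  finally show ?thesis
    by (simp add: inner_eq_Re_cinner complex_eq_iff)
qed

lemma cinner_eq_0_commute: "cinner x y = 0 \<longleftrightarrow> cinner y x = 0" for x y :: "'a::complex_inner"
  by (metis cinner_commute complex_cnj_zero)

lemma inner_eq_0_if_cinner: "cinner x y = 0 \<Longrightarrow> inner x y = 0" for x y :: "'a::complex_inner"
  by (simp add: inner_eq_Re_cinner)

lemma subspace_if_complex: "complex_vector.subspace U \<Longrightarrow> subspace U"
  by (simp add: subspace_def complex_vector.subspace_def scaleR_scaleC)

text \<open>Exhibits the complement as the common kernel of real functionals, finitely many if
  \<open>S\<close> is finite. Closedness and the later finite-codimension arguments rest on this
  form.\<close>

lemma orthogonal_complement_altdef: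
  "orthogonal_complement S = (\<Inter>y\<in>S \<union> scaleC \<i> ` S. {x. inner x y = 0})"
  by (auto simp: orthogonal_complement_def cinner_eq_0_iff_inner)

lemma closed_orthogonal_complement: "closed (orthogonal_complement S)"
  unfolding orthogonal_complement_altdef
  by (intro closed_INT ballI closed_Collect_eq continuous_intros)

lemma cinner_0_left: "cinner 0 y = 0" for y :: "'a::complex_inner"
  using cinner_add_left[of 0 0 y] by simp

lemma subspace_orthogonal_complement: "complex_vector.subspace (orthogonal_complement S)"
  by (simp add: complex_vector.subspace_def orthogonal_complement_def cinner_0_left cinner_add_left
      cinner_scaleC_left)

lemma orthogonal_complementI_inner:
  assumes "complex_vector.subspace U" "\<And>v. v \<in> U \<Longrightarrow> inner x v = 0"
  shows "x \<in> orthogonal_complement U"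
  using assms by (auto simp: orthogonal_complement_def cinner_eq_0_iff_inner complex_vector.subspace_scale)

lemma in_double_orthogonal_complement:
  assumes "u \<in> U" shows "u \<in> orthogonal_complement (orthogonal_complement U)"
  using assms by (auto simp: orthogonal_complement_def cinner_eq_0_commute)

lemma orthogonal_complement_Int:
  assumes "x \<in> U" "x \<in> orthogonal_complement U" shows "x = 0"
  using assms inner_eq_0_if_cinner[of x x] by (auto simp: orthogonal_complement_def)

lemma complex_orthogonal_decomposition:
  fixes U :: "'a::chilbert_space set"
  assumes "complex_vector.subspace U" "closed U"
  obtains u v where "u \<in> U" "v \<in> orthogonal_complement U" "x = u + v"
proof -
  obtain u where u: "u \<in> U" "\<And>v. v \<in> U \<Longrightarrow> inner (x - u) v = 0"
    using orthogonal_decomposition[OF subspace_if_complex[OF assms(1)] assms(2)] by blast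
  show ?thesis
    using that[of u "x - u"] u orthogonal_complementI_inner[OF assms(1)] by simp
qed

text \<open>For finite \<open>S\<close> the second condition on \<open>S\<close> expresses that
  \<open>U\<close> is finite-dimensional, without choosing a basis. If \<open>x\<close> is
  orthogonal to \<open>S\<close>, so is its component in \<open>U\<close>, which must then
  vanish.\<close>

lemma orthogonal_complement_finite_dimensional:
  fixes U :: "'a::chilbert_space set"
  assumes U: "complex_vector.subspace U" "closed U"
    and S: "S \<subseteq> U" "U \<inter> orthogonal_complement S \<subseteq> {0}"
  shows "orthogonal_complement U = orthogonal_complement S"
proof
  show "orthogonal_complement U \<subseteq> orthogonal_complement S"
    using S(1) by (auto simp: orthogonal_complement_def)
  show "orthogonal_complement S \<subseteq> orthogonal_complement U"
  proof
    fix x assume x: "x \<in> orthogonal_complement S"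
    obtain u v where uv: "u \<in> U" "v \<in> orthogonal_complement U" "x = u + v"
      using complex_orthogonal_decomposition[OF U] .
    have "v \<in> orthogonal_complement S" using uv(2) S(1) by (auto simp: orthogonal_complement_def)
    then have "x - v \<in> orthogonal_complement S"
      by (rule complex_vector.subspace_diff[OF subspace_orthogonal_complement x])
    then have "u = 0" using uv S(2) by auto
    then show "x \<in> orthogonal_complement U" using uv by simp
  qed
qed

lemma bounded_operators_iff:
  "T \<in> bounded_operators \<longleftrightarrow> (\<forall>c x. blinfun_apply T (c *\<^sub>C x) = c *\<^sub>C blinfun_apply T x)"
  by (auto simp: bounded_operators_def Vector_Spaces.linear_iff blinfun.add_right
      complex_vector.vector_space_axioms)

text \<open>Uniqueness of the decomposition makes the choice of components complex-linear;
  Pythagoras makes it a contraction.\<close>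

lemma orthogonal_projection:
  fixes U :: "'a::chilbert_space set"
  assumes U: "complex_vector.subspace U" "closed U"
  obtains P :: "'a \<Rightarrow>\<^sub>L 'a" where "P \<in> bounded_operators"
    "\<And>x. blinfun_apply P x \<in> U" "\<And>x. x - blinfun_apply P x \<in> orthogonal_complement U"
    "\<And>x. norm (blinfun_apply P x) \<le> norm x"
proof -
  have "\<exists>u. u \<in> U \<and> x - u \<in> orthogonal_complement U" for x
  proof -
    obtain u v where "u \<in> U" "v \<in> orthogonal_complement U" "x = u + v"
      using complex_orthogonal_decomposition[OF U] .
    then show ?thesis by (intro exI[of _ u]) simp
  qed
  then have "\<exists>p. \<forall>x. p x \<in> U \<and> x - p x \<in> orthogonal_complement U"
    by (intro choice allI)
  then obtain p where p: "\<And>x. p x \<in> U" "\<And>x. x - p x \<in> orthogonal_complement U"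
    by blast
  have uniq: "p x = u" if "u \<in> U" "x - u \<in> orthogonal_complement U" for x u
  proof -
    have "p x - u \<in> U" using U(1) p(1) that(1) by (simp add: complex_vector.subspace_diff)
    moreover have "(x - u) - (x - p x) \<in> orthogonal_complement U"
      using subspace_orthogonal_complement that(2) p(2) by (rule complex_vector.subspace_diff)
    ultimately have "p x - u = 0" using orthogonal_complement_Int[of "p x - u" U] by simp
    then show ?thesis by simp
  qed
  have add: "p (x + y) = p x + p y" for x y
  proof (rule uniq)
    show "p x + p y \<in> U" using U(1) p(1) by (simp add: complex_vector.subspace_add)
    have "(x - p x) + (y - p y) \<in> orthogonal_complement U"
      using subspace_orthogonal_complement p(2) p(2) by (rule complex_vector.subspace_add)
    then show "x + y - (p x + p y) \<in> orthogonal_complement U" by (simp add: algebra_simps)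
  qed
  have scale: "p (c *\<^sub>C x) = c *\<^sub>C p x" for c x
  proof (rule uniq)
    show "c *\<^sub>C p x \<in> U" using U(1) p(1) by (simp add: complex_vector.subspace_scale)
    have "c *\<^sub>C (x - p x) \<in> orthogonal_complement U"
      using subspace_orthogonal_complement p(2) by (rule complex_vector.subspace_scale)
    then show "c *\<^sub>C x - c *\<^sub>C p x \<in> orthogonal_complement U"
      by (simp add: complex_vector.scale_right_diff_distrib)
  qed
  have norm: "norm (p x) \<le> norm x" for x
  proof -
    have "inner (x - p x) (p x) = 0"
      using p inner_eq_0_if_cinner[of "x - p x" "p x"] by (simp add: orthogonal_complement_def)
    then have "(norm ((x - p x) + p x))\<^sup>2 = (norm (x - p x))\<^sup>2 + (norm (p x))\<^sup>2"
      by (intro norm_add_Pythagorean) (simp add: orthogonal_def)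
    then have "(norm (p x))\<^sup>2 \<le> (norm x)\<^sup>2" by simp
    then show ?thesis by (rule power2_le_imp_le) simp
  qed
  have bl: "bounded_linear p"
    by (rule bounded_linear_intro[where K = 1]) (simp_all add: add scale scaleR_scaleC norm)
  show ?thesis
  proof (rule that)
    show "Blinfun p \<in> bounded_operators"
      by (simp only: bounded_operators_iff bounded_linear_Blinfun_apply[OF bl] scale simp_thms)
  qed (simp_all only: bounded_linear_Blinfun_apply[OF bl] p norm)
qed

section \<open>A criterion for absolute norm attainment\<close>

text \<open>Passing to the kernel of one functional removes at most one dimension, so a subspace
  whose points are separated from \<open>0\<close> by finitely many functionals is
  finite-dimensional.\<close>

lemma subspace_eq_span_finite:
  fixes E :: "'a::real_normed_vector set" and \<Phi> :: "('a \<Rightarrow> real) set"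
  assumes "finite \<Phi>" "\<And>f. f \<in> \<Phi> \<Longrightarrow> linear f" "subspace E"
    and "\<And>x. x \<in> E \<Longrightarrow> (\<And>f. f \<in> \<Phi> \<Longrightarrow> f x = 0) \<Longrightarrow> x = 0"
  shows "\<exists>B. finite B \<and> E = span B"
  using assms
proof (induction \<Phi> arbitrary: E rule: finite_induct)
  case empty
  then have "E = {0}" using subspace_0 by blast
  then show ?case by (intro exI[of _ "{}"]) simp
next
  case (insert f \<Phi>)
  have lin: "linear f" using insert.prems(1) by simp
  define E' where "E' = E \<inter> {x. f x = 0}"
  have "subspace E'"
    unfolding E'_def using insert.prems(2) linear_subspace_kernel[OF lin] by (rule subspace_inter)
  moreover have "x = 0" if "x \<in> E'" "\<And>g. g \<in> \<Phi> \<Longrightarrow> g x = 0" for x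
    using insert.prems(3)[of x] that by (auto simp: E'_def)
  ultimately obtain B where B: "finite B" "E' = span B"
    using insert.IH[of E'] insert.prems(1) by (meson insertCI)
  show ?case
  proof (cases "E = E'")
    case False
    then obtain e where e: "e \<in> E" "f e \<noteq> 0" by (auto simp: E'_def)
    have "E = span (insert e B)"
    proof
      show "E \<subseteq> span (insert e B)"
      proof
        fix x assume x: "x \<in> E"
        have "x - (f x / f e) *\<^sub>R e \<in> span B"
          using x e insert.prems(2)
          by (simp add: B(2)[symmetric] E'_def subspace_diff subspace_scale linear_diff[OF lin]
              linear_scale[OF lin])
        then show "x \<in> span (insert e B)" by (auto simp: span_breakdown_eq)
      qed
      have "B \<subseteq> E" using B(2) span_superset by (auto simp: E'_def)
      then show "span (insert e B) \<subseteq> E" using e(1) insert.prems(2) by (intro span_minimal) auto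
    qed
    then show ?thesis using B(1) by blast
  qed (use B in blast)
qed

text \<open>The ambient space may be infinite-dimensional, so compactness is built up one orthogonal
  direction at a time: Pythagoras bounds both the coefficient of the new direction and the
  remainder.\<close>

lemma compact_cball_span_orthogonal:
  fixes C :: "'a::real_inner set"
  assumes "finite C" "pairwise orthogonal C"
  shows "compact (span C \<inter> cball 0 1)"
  using assms
proof (induction C rule: finite_induct)
  case empty
  then show ?case by simp
next
  case (insert c C)
  have IH: "compact (span C \<inter> cball 0 1)"
    using insert.IH insert.prems pairwise_subset by blast
  show ?case
  proof (cases "c = 0")
    case True
    then show ?thesis using IH by (simp add: span_insert_0)
  next
    case False
    define r where "r = 1 / norm c"
    \<comment> \<open>A compact set containing the new unit ball; \<open>r\<close> is the largest
      coefficient of \<open>c\<close> that a vector of norm at most \<open>1\<close> can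
      have.\<close>
    define D where "D = (\<lambda>(t, y). t *\<^sub>R c + y) ` ({- r..r} \<times> (span C \<inter> cball 0 1))"
    have "compact D" unfolding D_def
      by (intro compact_continuous_image compact_Times IH compact_Icc)
        (auto intro!: continuous_intros simp: case_prod_beta)
    then have "compact (D \<inter> cball 0 1)" by (rule compact_Int_closed) simp
    also have "D \<inter> cball 0 1 = span (insert c C) \<inter> cball 0 1"
    proof -
      have "x \<in> span (insert c C)" if "x \<in> D" for x
      proof -
        obtain t y where "x = t *\<^sub>R c + y" "y \<in> span C" using \<open>x \<in> D\<close> by (auto simp: D_def)
        then show ?thesis by (auto simp: span_breakdown_eq intro!: exI[of _ t])
      qed
      moreover have "x \<in> D" if x: "x \<in> span (insert c C)" "norm x \<le> 1" for x
      proof -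
        obtain t where t: "x - t *\<^sub>R c \<in> span C" using x(1) by (auto simp: span_breakdown_eq)
        have "orthogonal c y" if "y \<in> span C" for y
          using that by (rule orthogonal_to_span)
            (use insert in \<open>auto simp: pairwise_insert\<close>)
        with t have "orthogonal (t *\<^sub>R c) (x - t *\<^sub>R c)" by (simp add: orthogonal_def)
        from norm_add_Pythagorean[OF this]
        have n: "(norm x)\<^sup>2 = (norm (t *\<^sub>R c))\<^sup>2 + (norm (x - t *\<^sub>R c))\<^sup>2" by simp
        have "(norm x)\<^sup>2 \<le> 1" using x(2) by (simp add: power_le_one)
        then have "(norm (t *\<^sub>R c))\<^sup>2 \<le> 1\<^sup>2" "(norm (x - t *\<^sub>R c))\<^sup>2 \<le> 1\<^sup>2"
          using n zero_le_power2[of "norm (t *\<^sub>R c)"] zero_le_power2[of "norm (x - t *\<^sub>R c)"]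
          unfolding one_power2 by linarith+
        then have "norm (t *\<^sub>R c) \<le> 1" "norm (x - t *\<^sub>R c) \<le> 1"
          by (auto intro: power2_le_imp_le simp del: one_power2)
        then have "\<bar>t\<bar> \<le> r" "norm (x - t *\<^sub>R c) \<le> 1"
          using False by (simp_all add: r_def field_simps)
        then show ?thesis unfolding D_def
          using t by (intro image_eqI[of _ _ "(t, x - t *\<^sub>R c)"]) auto
      qed
      ultimately show ?thesis by auto
    qed
    finally show ?thesis .
  qed
qed

lemma norm_attained_on_finite_dimensional:
  fixes T :: "'a::real_inner \<Rightarrow>\<^sub>L 'b::real_normed_vector"
  assumes "finite B" "span B \<noteq> {0}"
  obtains e where "e \<in> span B" "norm e = 1"
    "\<And>y. y \<in> span B \<Longrightarrow> norm (blinfun_apply T y) \<le> norm (blinfun_apply T e) * norm y"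
proof -
  obtain C where C: "finite C" "span C = span B" "pairwise orthogonal C"
    using basis_orthogonal[OF assms(1)] by blast
  have unit: "(1 / norm y) *\<^sub>R y \<in> span B \<inter> sphere 0 1" if "y \<in> span B" "y \<noteq> 0" for y
    using that by (simp add: span_scale)
  have "compact (span B \<inter> cball 0 1 \<inter> sphere 0 1)"
    using compact_cball_span_orthogonal[OF C(1,3)] unfolding C(2)
    by (rule compact_Int_closed) (unfold sphere_def, intro closed_Collect_eq continuous_intros)
  moreover have "span B \<inter> cball 0 1 \<inter> sphere 0 1 = span B \<inter> sphere 0 1" by auto
  ultimately have "compact (span B \<inter> sphere 0 1)" by simp
  moreover have "span B \<inter> sphere 0 1 \<noteq> {}"
  proof -
    obtain y where "y \<in> span B" "y \<noteq> 0" using assms(2) span_zero[of B] by blast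
    from unit[OF this] show ?thesis by blast
  qed
  moreover have "continuous_on (span B \<inter> sphere 0 1) (\<lambda>x. norm (blinfun_apply T x))"
    by (intro continuous_intros)
  ultimately have "\<exists>e\<in>span B \<inter> sphere 0 1. \<forall>y\<in>span B \<inter> sphere 0 1.
      norm (blinfun_apply T y) \<le> norm (blinfun_apply T e)"
    by (rule continuous_attains_sup)
  then obtain e where e: "e \<in> span B \<inter> sphere 0 1"
    "\<And>y. y \<in> span B \<inter> sphere 0 1 \<Longrightarrow> norm (blinfun_apply T y) \<le> norm (blinfun_apply T e)"
    by blast
  have "norm (blinfun_apply T y) \<le> norm (blinfun_apply T e) * norm y" if "y \<in> span B" for y
  proof (cases "y = 0")
    case False
    then show ?thesis
      using e(2)[OF unit[OF that False]] by (simp add: blinfun.scaleR_right field_simps)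
  qed simp
  with e(1) show ?thesis by (intro that) auto
qed

section \<open>Norm attainment on a subspace\<close>

lemma bdd_above_norm_on: "bdd_above ((\<lambda>x. norm (blinfun_apply T x) / norm x) ` M)"
proof (rule bdd_aboveI2)
  show "norm (blinfun_apply T x) / norm x \<le> norm T" for x
    using norm_blinfun[of T x] by (cases "x = 0") (simp_all add: divide_le_eq)
qed

lemma norm_le_norm_on:
  assumes "x \<in> M" shows "norm (blinfun_apply T x) / norm x \<le> norm_on M T"
  unfolding norm_on_def by (rule cSUP_upper[OF assms bdd_above_norm_on])

text \<open>Replaces the supremum of quotients by a homogeneous inequality, which is easier to
  combine over orthogonal summands.\<close>

lemma norm_attaining_onI:
  assumes "m \<in> M" "norm m = 1"
    and le: "\<And>x. x \<in> M \<Longrightarrow> norm (blinfun_apply T x) \<le> norm (blinfun_apply T m) * norm x"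
  shows "norm_attaining_on M T"
proof -
  have "norm_on M T \<le> norm (blinfun_apply T m)"
    unfolding norm_on_def
  proof (rule cSUP_least)
    show "norm (blinfun_apply T x) / norm x \<le> norm (blinfun_apply T m)" if "x \<in> M" for x
      using le[OF that] by (cases "x = 0") (simp_all add: field_simps)
  qed (use assms in auto)
  moreover have "norm (blinfun_apply T m) \<le> norm_on M T"
    using norm_le_norm_on[OF assms(1), of T] assms(2) by simp
  ultimately show ?thesis using assms unfolding norm_attaining_on_def by force
qed

text \<open>On a subspace \<open>M\<close> the hypothesis splits \<open>M\<close> orthogonally into \<open>M \<inter> R\<close>, on which \<open>T\<close> is
  \<open>\<beta>\<close> times an isometry, and a finite-dimensional rest whose image is orthogonal to that of
  \<open>M \<inter> R\<close>; the norm is attained on one of the two summands.\<close>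

lemma AN_operators_if_scaled_isometry_on_finite_codimension:
  fixes T :: "'a::chilbert_space \<Rightarrow>\<^sub>L 'b::chilbert_space" and \<Phi> :: "('a \<Rightarrow> real) set"
  assumes T: "T \<in> bounded_operators"
    and \<Phi>: "finite \<Phi>" "\<And>f. f \<in> \<Phi> \<Longrightarrow> bounded_linear f"
    and R: "R = {x. \<forall>f\<in>\<Phi>. f x = 0}"
    and \<beta>: "\<beta> \<ge> 0"
    and iso: "\<And>x l. l \<in> R \<Longrightarrow> inner (blinfun_apply T x) (blinfun_apply T l) = \<beta>\<^sup>2 * inner x l"
  shows "T \<in> AN_operators"
proof -
  have "norm_attaining_on M T" if cM: "complex_vector.subspace M" and M: "closed M" "M \<noteq> {0}" for M
  proof -
    have sM: "subspace M" using cM by (rule subspace_if_complex)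
    have R_Int: "R = (\<Inter>f\<in>\<Phi>. {x. f x = 0})" by (auto simp: R)
    have "closed R" unfolding R_Int
      by (intro closed_INT ballI closed_Collect_eq continuous_intros
          linear_continuous_on \<Phi>)
    have "subspace R" unfolding R_Int
      by (rule subspace_Inter)
        (use \<Phi>(2) in \<open>auto intro: linear_subspace_kernel bounded_linear.linear\<close>)
    define L where "L = M \<inter> R"
    have L: "subspace L" "closed L" unfolding L_def
      using sM \<open>subspace R\<close> M(1) \<open>closed R\<close> by (auto intro: subspace_inter)
    define E where "E = M \<inter> {x. \<forall>l\<in>L. inner x l = 0}"
    have "subspace E" unfolding E_def using sM
      by (auto simp: subspace_def inner_add_left)
    moreover have "x = 0" if "x \<in> E" "\<And>f. f \<in> \<Phi> \<Longrightarrow> f x = 0" for x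
    proof -
      \<comment> \<open>A vector of \<open>E\<close> killed by all of \<open>\<Phi>\<close> lies in
        \<open>L\<close>, hence is orthogonal to itself.\<close>
      have "x \<in> L" using that by (auto simp: E_def L_def R)
      then have "inner x x = 0" using that(1) by (auto simp: E_def)
      then show ?thesis by simp
    qed
    ultimately have "\<exists>B. finite B \<and> E = span B"
      by (intro subspace_eq_span_finite[OF \<Phi>(1)]) (use \<Phi>(2) bounded_linear.linear in auto)
    then obtain B where B: "finite B" "E = span B" by blast
    have split: "\<exists>e\<in>E. \<exists>l\<in>L. x = e + l" if "x \<in> M" for x
    proof -
      obtain l where l: "l \<in> L" "\<And>v. v \<in> L \<Longrightarrow> inner (x - l) v = 0"
        using orthogonal_decomposition[OF L] by blast
      then have "x - l \<in> E" using that sM by (auto simp: E_def L_def subspace_diff)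
      then show ?thesis using l(1) by (metis diff_add_cancel)
    qed
    have TL: "norm (blinfun_apply T l) = \<beta> * norm l" if "l \<in> L" for l
    proof -
      have "(norm (blinfun_apply T l))\<^sup>2 = (\<beta> * norm l)\<^sup>2"
        using iso[of l l] that by (simp add: L_def power2_norm_eq_inner power_mult_distrib)
      then show ?thesis using \<beta> by (simp add: power2_eq_iff_nonneg)
    qed
    \<comment> \<open>One unit vector has to dominate on both summands: compare a maximizer on
      \<open>E\<close> with any unit vector of \<open>L\<close>, where the value is the constant
      \<open>\<beta>\<close>.\<close>
    have "\<exists>m\<in>M. norm m = 1 \<and> (\<forall>e\<in>E. norm (blinfun_apply T e) \<le> norm (blinfun_apply T m) * norm e)
        \<and> (\<forall>l\<in>L. norm (blinfun_apply T l) \<le> norm (blinfun_apply T m) * norm l)"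
      (is "\<exists>m\<in>M. norm m = 1 \<and> ?E m \<and> ?L m")
    proof -
      have E: "\<exists>e\<in>E. norm e = 1 \<and> ?E e" if "E \<noteq> {0}"
        using norm_attained_on_finite_dimensional[OF B(1), of T] that unfolding B(2) by metis
      have L0: "\<exists>l\<in>L. norm l = 1 \<and> norm (blinfun_apply T l) = \<beta>" if nz: "L \<noteq> {0}"
      proof -
        obtain l where l: "l \<in> L" "l \<noteq> 0" using nz subspace_0[OF L(1)] by blast
        then have "(1 / norm l) *\<^sub>R l \<in> L" using L(1) by (simp add: subspace_scale)
        then show ?thesis using l TL[of "(1 / norm l) *\<^sub>R l"]
          by (intro bexI[of _ "(1 / norm l) *\<^sub>R l"]) auto
      qed
      have sub: "E \<subseteq> M" "L \<subseteq> M" by (auto simp: E_def L_def)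
      consider "E = {0}" "L \<noteq> {0}" | "E \<noteq> {0}" "L = {0}" | "E \<noteq> {0}" "L \<noteq> {0}"
      proof -
        have "\<not> (E = {0} \<and> L = {0})"
        proof
          assume *: "E = {0} \<and> L = {0}"
          have "M \<subseteq> {0}"
          proof
            fix x assume "x \<in> M"
            from split[OF this] * show "x \<in> {0}" by auto
          qed
          then show False using M(2) subspace_0[OF sM] by blast
        qed
        then show ?thesis using that by blast
      qed
      then show ?thesis
      proof cases
        case 1
        then obtain l where "l \<in> L" "norm l = 1" "norm (blinfun_apply T l) = \<beta>" using L0 by blast
        then show ?thesis using sub 1 TL by (intro bexI[of _ l]) auto
      next
        case 2
        then obtain e where "e \<in> E" "norm e = 1" "?E e" using E by blast
        then show ?thesis using sub 2 by (intro bexI[of _ e]) auto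
      next
        case 3
        then obtain l e where l: "l \<in> L" "norm l = 1" "norm (blinfun_apply T l) = \<beta>"
          and e: "e \<in> E" "norm e = 1" "?E e" using L0 E by blast
        show ?thesis
        proof (cases "norm (blinfun_apply T e) \<le> \<beta>")
          case True
          then have "?E l" using e(3) l(3) by (meson mult_right_mono norm_ge_zero order_trans)
          then show ?thesis using sub l TL by (intro bexI[of _ l]) auto
        next
          case False
          then have "?L e" using TL by (simp add: mult_right_mono)
          then show ?thesis using sub e by (intro bexI[of _ e]) auto
        qed
      qed
    qed
    then obtain m where m: "m \<in> M" "norm m = 1" "?E m" "?L m" by blast
    show ?thesis
    proof (rule norm_attaining_onI[OF m(1,2)])
      fix x assume "x \<in> M"
      then obtain e l where el: "e \<in> E" "l \<in> L" "x = e + l" using split by blast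
      let ?c = "norm (blinfun_apply T m)"
      have o: "inner e l = 0" using el by (auto simp: E_def)
      \<comment> \<open>The images stay orthogonal, so Pythagoras adds the bounds on the two
        summands.\<close>
      then have o': "inner (blinfun_apply T e) (blinfun_apply T l) = 0"
        using iso[of l e] el(2) by (simp add: L_def)
      have "(norm (blinfun_apply T x))\<^sup>2 = (norm (blinfun_apply T e))\<^sup>2 + (norm (blinfun_apply T l))\<^sup>2"
        using o' by (simp add: el(3) blinfun.add_right norm_add_Pythagorean orthogonal_def)
      also have "\<dots> \<le> (?c * norm e)\<^sup>2 + (?c * norm l)\<^sup>2"
        using m(3,4) el(1,2) by (intro add_mono power_mono) auto
      also have "\<dots> = (?c * norm x)\<^sup>2"
        using o by (simp add: el(3) norm_add_Pythagorean orthogonal_def power_mult_distrib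
            distrib_left)
      finally show "norm (blinfun_apply T x) \<le> ?c * norm x"
        by (rule power2_le_imp_le) simp
    qed
  qed
  with T show ?thesis by (auto simp: AN_operators_def)
qed

section \<open>Partial isometries\<close>

lemma closed_null_space: "closed (null_space T)"
  unfolding null_space_def by (intro closed_Collect_eq continuous_intros)

lemma subspace_null_space: "T \<in> bounded_operators \<Longrightarrow> complex_vector.subspace (null_space T)"
  by (simp add: complex_vector.subspace_def null_space_def blinfun.zero_right blinfun.add_right
      bounded_operators_iff)

text \<open>By polarization \<open>W\<close> preserves inner products on its initial space; the
  component of \<open>x\<close> in the null space contributes to neither side.\<close>

lemma partial_isometry_inner:
  fixes W :: "'a::chilbert_space \<Rightarrow>\<^sub>L 'b::chilbert_space"
  assumes W: "partial_isometry W" and l: "l \<in> orthogonal_complement (null_space W)"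
  shows "inner (blinfun_apply W x) (blinfun_apply W l) = inner x l"
proof -
  let ?N = "null_space W"
  have Wb: "W \<in> bounded_operators" using W by (simp add: partial_isometry_def)
  obtain n m where nm: "n \<in> ?N" "m \<in> orthogonal_complement ?N" "x = n + m"
    using complex_orthogonal_decomposition[OF subspace_null_space[OF Wb] closed_null_space] .
  have iso: "norm (blinfun_apply W y) = norm y" if "y \<in> orthogonal_complement ?N" for y
    using W that by (simp add: partial_isometry_def)
  have ml: "m + l \<in> orthogonal_complement ?N"
    using subspace_orthogonal_complement nm(2) l by (rule complex_vector.subspace_add)
  have "inner (blinfun_apply W m) (blinfun_apply W l) = inner m l"
    using iso[OF ml] iso[OF nm(2)] iso[OF l]
    by (simp add: dot_norm blinfun.add_right)
  moreover have "blinfun_apply W x = blinfun_apply W m"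
    using nm by (simp add: null_space_def blinfun.add_right)
  moreover have "inner l n = 0"
    using nm(1) l by (auto simp: orthogonal_complement_def intro: inner_eq_0_if_cinner)
  ultimately show ?thesis by (simp add: nm(3) inner_add_left inner_commute[of n l])
qed

text \<open>Only the component in the initial space survives under \<open>W\<close>, so by
  Pythagoras no norm is left for the component in the null space.\<close>

lemma partial_isometry_norm_ge:
  fixes W :: "'a::chilbert_space \<Rightarrow>\<^sub>L 'b::chilbert_space"
  assumes W: "partial_isometry W" and x: "norm x \<le> norm (blinfun_apply W x)"
  shows "x \<in> orthogonal_complement (null_space W)"
proof -
  let ?N = "null_space W"
  have Wb: "W \<in> bounded_operators" using W by (simp add: partial_isometry_def)
  obtain n m where nm: "n \<in> ?N" "m \<in> orthogonal_complement ?N" "x = n + m"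
    using complex_orthogonal_decomposition[OF subspace_null_space[OF Wb] closed_null_space] .
  have "blinfun_apply W x = blinfun_apply W m"
    using nm by (simp add: null_space_def blinfun.add_right)
  then have le: "norm x \<le> norm m" using W x nm(2) by (simp add: partial_isometry_def)
  have "inner m n = 0"
    using nm(1,2) by (auto simp: orthogonal_complement_def intro: inner_eq_0_if_cinner)
  then have "(norm x)\<^sup>2 = (norm n)\<^sup>2 + (norm m)\<^sup>2"
    by (simp add: nm(3) norm_add_Pythagorean orthogonal_def inner_commute)
  moreover have "(norm x)\<^sup>2 \<le> (norm m)\<^sup>2" using le by (simp add: power_mono)
  ultimately have "n = 0" by simp
  then show ?thesis using nm by simp
qed

text \<open>The hypothesis \<open>inf\<close> states infinite dimension: after finitely many choices
  some nonzero vector of \<open>U\<close> is orthogonal to all of them and can be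
  normalized.\<close>

lemma orthonormal_sequence_exists:
  fixes U :: "'a::complex_inner set"
  assumes U: "complex_vector.subspace U"
    and inf: "\<And>S. finite S \<Longrightarrow> S \<subseteq> U \<Longrightarrow> \<not> U \<inter> orthogonal_complement S \<subseteq> {0}"
  shows "\<exists>f::nat \<Rightarrow> 'a. (\<forall>n. f n \<in> U \<and> norm (f n) = 1) \<and>
    (\<forall>m n. m \<noteq> n \<longrightarrow> cinner (f m) (f n) = 0)"
proof -
  have "\<exists>f::nat \<Rightarrow> 'a. \<forall>n. f n \<in> U \<and> norm (f n) = 1 \<and> (\<forall>m<n. cinner (f n) (f m) = 0)"
  proof (rule dependent_wellorder_choice)
    fix n :: nat and f :: "nat \<Rightarrow> 'a"
    assume IH: "\<And>y. y < n \<Longrightarrow> f y \<in> U \<and> norm (f y) = 1 \<and> (\<forall>m<y. cinner (f y) (f m) = 0)"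
    have "\<not> U \<inter> orthogonal_complement (f ` {..<n}) \<subseteq> {0}"
      using IH by (intro inf) auto
    then obtain x where x: "x \<in> U" "x \<in> orthogonal_complement (f ` {..<n})" "x \<noteq> 0" by blast
    let ?r = "(1 / norm x) *\<^sub>R x"
    have "?r \<in> U" using subspace_if_complex[OF U] x(1) by (rule subspace_scale)
    moreover have "?r \<in> orthogonal_complement (f ` {..<n})"
      using subspace_if_complex[OF subspace_orthogonal_complement] x(2) by (rule subspace_scale)
    ultimately show "\<exists>r. r \<in> U \<and> norm r = 1 \<and> (\<forall>m<n. cinner r (f m) = 0)"
      using x(3) by (intro exI[of _ ?r]) (auto simp: orthogonal_complement_def)
  qed auto
  then obtain f :: "nat \<Rightarrow> 'a" where f: "\<And>n. f n \<in> U" "\<And>n. norm (f n) = 1"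
    "\<And>m n. m < n \<Longrightarrow> cinner (f n) (f m) = 0" by blast
  have "cinner (f m) (f n) = 0" if "m \<noteq> n" for m n
    using that f(3) cinner_eq_0_commute by (metis nat_neq_iff)
  with f(1,2) show ?thesis by blast
qed

lemma cinner_add_right: "cinner x (y + z) = cinner x y + cinner x z" for x y z :: "'a::complex_inner"
  by (metis cinner_add_left cinner_commute complex_cnj_add)

lemma cinner_scaleR_left: "cinner (r *\<^sub>R x) y = of_real r * cinner x y" for x y :: "'a::complex_inner"
  by (simp add: scaleR_scaleC cinner_scaleC_left)

lemma cinner_scaleR_right: "cinner x (r *\<^sub>R y) = of_real r * cinner x y" for x y :: "'a::complex_inner"
  by (metis cinner_commute cinner_scaleR_left complex_cnj_mult complex_cnj_complex_of_real)

text \<open>Otherwise take orthonormal sequences \<open>e\<close> in the initial space and \<open>f\<close> in the null space: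
  on the closed span of the vectors \<open>g n = e n + t n f n\<close> with \<open>t n\<close> tending to \<open>0\<close> the
  supremum \<open>1\<close> is approached along \<open>g\<close> but not attained.\<close>

lemma AN_partial_isometry_finite_dimensional:
  fixes W :: "'a::chilbert_space \<Rightarrow>\<^sub>L 'b::chilbert_space"
  assumes AN: "W \<in> AN_operators" and W: "partial_isometry W"
  shows "\<exists>U S. (U = null_space W \<or> U = orthogonal_complement (null_space W)) \<and>
    finite S \<and> S \<subseteq> U \<and> U \<inter> orthogonal_complement S \<subseteq> {0}"
proof (rule ccontr)
  assume contr: "\<not> ?thesis"
  let ?N = "null_space W"
  let ?N' = "orthogonal_complement ?N"
  have Wb: "W \<in> bounded_operators" using W by (simp add: partial_isometry_def)
  have inf: "\<not> U \<inter> orthogonal_complement S \<subseteq> {0}"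
    if "U = ?N \<or> U = ?N'" "finite S" "S \<subseteq> U" for U S
  proof
    assume "U \<inter> orthogonal_complement S \<subseteq> {0}"
    with that have "\<exists>U S. (U = ?N \<or> U = ?N') \<and> finite S \<and> S \<subseteq> U \<and>
        U \<inter> orthogonal_complement S \<subseteq> {0}"
      by (intro exI[of _ U] exI[of _ S]) simp
    with contr show False by (rule notE)
  qed
  have "\<exists>f::nat \<Rightarrow> 'a. (\<forall>n. f n \<in> ?N \<and> norm (f n) = 1) \<and>
      (\<forall>m n. m \<noteq> n \<longrightarrow> cinner (f m) (f n) = 0)"
    by (rule orthonormal_sequence_exists[OF subspace_null_space[OF Wb]]) (simp add: inf)
  then obtain f :: "nat \<Rightarrow> 'a" where f: "\<And>n. f n \<in> ?N" "\<And>n. norm (f n) = 1"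
    "\<And>m n. m \<noteq> n \<Longrightarrow> cinner (f m) (f n) = 0" by blast
  have "\<exists>f::nat \<Rightarrow> 'a. (\<forall>n. f n \<in> ?N' \<and> norm (f n) = 1) \<and>
      (\<forall>m n. m \<noteq> n \<longrightarrow> cinner (f m) (f n) = 0)"
    by (rule orthonormal_sequence_exists[OF subspace_orthogonal_complement]) (simp add: inf)
  then obtain e :: "nat \<Rightarrow> 'a" where e: "\<And>n. e n \<in> ?N'" "\<And>n. norm (e n) = 1"
    "\<And>m n. m \<noteq> n \<Longrightarrow> cinner (e m) (e n) = 0" by blast
  have ef: "cinner (e m) (f n) = 0" for m n
    using e(1) f(1) by (auto simp: orthogonal_complement_def)
  then have fe: "cinner (f n) (e m) = 0" for m n
    by (simp add: cinner_eq_0_commute[of "f n"])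
  define t where "t n = inverse (real (Suc n))" for n
  have t: "t n > 0" for n by (simp add: t_def)
  define g where "g n = e n + t n *\<^sub>R f n" for n
  \<comment> \<open>The double complement serves as the closed complex span of the
    \<open>g n\<close>.\<close>
  define M where "M = orthogonal_complement (orthogonal_complement (range g))"
  have M: "complex_vector.subspace M" "closed M"
    by (simp_all add: M_def subspace_orthogonal_complement closed_orthogonal_complement)
  have gM: "g n \<in> M" for n
    unfolding M_def by (rule in_double_orthogonal_complement) simp
  have "inner (e n) (t n *\<^sub>R f n) = 0" for n by (simp add: inner_eq_0_if_cinner[OF ef])
  then have "(norm (g n))\<^sup>2 = 1 + (t n)\<^sup>2" for n
    by (simp add: g_def norm_add_Pythagorean orthogonal_def e(2) f(2))
  then have ng: "norm (g n) = sqrt (1 + (t n)\<^sup>2)" for n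
    by (metis norm_ge_zero real_sqrt_unique)
  have "blinfun_apply W (g n) = blinfun_apply W (e n)" for n
    using f(1) by (simp add: g_def blinfun.add_right blinfun.scaleR_right null_space_def)
  then have Wg: "norm (blinfun_apply W (g n)) = 1" for n
    using W e(1,2) by (simp add: partial_isometry_def)
  have "sqrt (1 + (t 0)\<^sup>2) \<noteq> 0" by (metis Wg blinfun.zero_right ng norm_eq_zero zero_neq_one)
  then have "g 0 \<noteq> 0" using ng[of 0] by auto
  then have "M \<noteq> {0}" using gM[of 0] by auto
  then obtain x where x: "x \<in> M" "norm x = 1" "norm (blinfun_apply W x) = norm_on M W"
    using AN M by (auto simp: AN_operators_def norm_attaining_on_def)
  \<comment> \<open>The quotient at \<open>g n\<close> is
    \<open>1 / sqrt (1 + (t n)\<^sup>2)\<close>, which tends to \<open>1\<close>. So the maximizer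
    \<open>x\<close> loses no norm under \<open>W\<close> and lies in the initial space.\<close>
  have "1 \<le> norm (blinfun_apply W x)"
  proof (rule LIMSEQ_le_const2)
    have "t \<longlonglongrightarrow> 0" using LIMSEQ_inverse_real_of_nat unfolding t_def .
    then have "(\<lambda>n. 1 / sqrt (1 + (t n)\<^sup>2)) \<longlonglongrightarrow> 1 / sqrt (1 + 0\<^sup>2)"
      by (intro tendsto_intros) auto
    then show "(\<lambda>n. 1 / sqrt (1 + (t n)\<^sup>2)) \<longlonglongrightarrow> 1" by simp
    show "\<exists>N. \<forall>n\<ge>N. 1 / sqrt (1 + (t n)\<^sup>2) \<le> norm (blinfun_apply W x)"
      using norm_le_norm_on[OF gM, of W] by (simp add: x(3) Wg ng)
  qed
  then have xN: "x \<in> ?N'" using W x(2) by (intro partial_isometry_norm_ge) auto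
  have "cinner x (g n) = 0" for n
  proof -
    \<comment> \<open>This vector is orthogonal to every \<open>g m\<close>: for
      \<open>m = n\<close> the two contributions \<open>t n\<close> cancel. Hence it is orthogonal
      to \<open>x\<close>; since \<open>x\<close> is orthogonal to \<open>f n\<close> and
      \<open>t n\<close> is nonzero, also \<open>e n\<close> is orthogonal to
      \<open>x\<close>.\<close>
    have "cinner (f n + (- t n) *\<^sub>R e n) (g m) = 0" for m
    proof (cases "m = n")
      case True
      then show ?thesis
        by (simp only: g_def cinner_add_left cinner_add_right cinner_scaleR_left
            cinner_scaleR_right ef fe cinner_self e(2) f(2)) simp
    next
      case False
      then show ?thesis
        by (simp only: g_def cinner_add_left cinner_add_right cinner_scaleR_left
            cinner_scaleR_right ef fe e(3) f(3) not_sym) simp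
    qed
    then have "f n + (- t n) *\<^sub>R e n \<in> orthogonal_complement (range g)"
      by (auto simp: orthogonal_complement_def)
    then have "cinner x (f n + (- t n) *\<^sub>R e n) = 0"
      using x(1) by (auto simp: M_def orthogonal_complement_def)
    moreover have xf: "cinner x (f n) = 0"
      using xN f(1) by (auto simp: orthogonal_complement_def)
    ultimately have "cinner x (e n) = 0"
      using t[of n] by (simp only: cinner_add_right cinner_scaleR_right) simp
    with xf show ?thesis by (simp add: g_def cinner_add_right cinner_scaleR_right)
  qed
  then have "x \<in> orthogonal_complement (range g)" by (auto simp: orthogonal_complement_def)
  then have "x = 0" using x(1) orthogonal_complement_Int unfolding M_def by blast
  then show False using x(2) by simp
qed

section \<open>Finite-rank perturbations\<close>

text \<open>The part of \<open>K\<close> projected to the complement of \<open>Y\<close> is small,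
  since every value of \<open>K\<close> on the unit ball is close to a point of \<open>Y\<close>,
  which the projection kills. Finite rank enters later only through the last two conclusions, on the
  range and the kernel of \<open>F\<close>.\<close>

lemma compact_operator_finite_rank_approximation:
  fixes K :: "'a::chilbert_space \<Rightarrow>\<^sub>L 'b::chilbert_space"
  assumes K: "K \<in> compact_operators" and \<epsilon>: "\<epsilon> > 0"
  obtains F Y where "F \<in> bounded_operators" "finite Y" "norm (K - F) \<le> \<epsilon>"
    "\<And>x. blinfun_apply F x \<in> orthogonal_complement (orthogonal_complement Y)"
    "\<And>x. blinfun_apply K x \<in> orthogonal_complement Y \<Longrightarrow> blinfun_apply F x = 0"
proof -
  have Kb: "K \<in> bounded_operators" using K by (simp add: compact_operators_def)
  let ?D = "blinfun_apply K ` cball 0 1"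
  have "compact (closure ?D)" using K by (auto simp: compact_operators_def)
  then obtain Y where Y: "finite Y" "closure ?D \<subseteq> (\<Union>y\<in>Y. ball y \<epsilon>)"
    using compactE_image[of "closure ?D" "closure ?D" "\<lambda>y. ball y \<epsilon>"] \<epsilon>
    by (metis UN_I centre_in_ball open_ball subsetI)
  obtain P :: "'b \<Rightarrow>\<^sub>L 'b" where P: "P \<in> bounded_operators"
    "\<And>x. blinfun_apply P x \<in> orthogonal_complement Y"
    "\<And>x. x - blinfun_apply P x \<in> orthogonal_complement (orthogonal_complement Y)"
    "\<And>x. norm (blinfun_apply P x) \<le> norm x"
    using orthogonal_projection[OF subspace_orthogonal_complement closed_orthogonal_complement, of Y]
    by metis
  have fixP: "blinfun_apply P x = x" if "x \<in> orthogonal_complement Y" for x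
    using orthogonal_complement_Int[OF complex_vector.subspace_diff[OF
          subspace_orthogonal_complement that P(2)[of x]] P(3)[of x]] by simp
  have PY: "blinfun_apply P y = 0" if "y \<in> Y" for y
  proof -
    have "y - (y - blinfun_apply P y) \<in> orthogonal_complement (orthogonal_complement Y)"
      using subspace_orthogonal_complement in_double_orthogonal_complement[OF that]
        P(3) by (rule complex_vector.subspace_diff)
    then show ?thesis using orthogonal_complement_Int[OF P(2)[of y]] by simp
  qed
  define F where "F = K - (P o\<^sub>L K)"
  have Fx: "blinfun_apply F x = blinfun_apply K x - blinfun_apply P (blinfun_apply K x)" for x
    by (simp add: F_def minus_blinfun.rep_eq)
  have le: "norm (blinfun_apply P (blinfun_apply K x)) \<le> \<epsilon>" if "norm x \<le> 1" for x
  proof -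
    have "blinfun_apply K x \<in> closure ?D" using that closure_subset by fastforce
    then obtain y where y: "y \<in> Y" "dist y (blinfun_apply K x) < \<epsilon>" using Y(2) by auto
    have "norm (blinfun_apply P (blinfun_apply K x)) = norm (blinfun_apply P (blinfun_apply K x - y))"
      by (simp add: blinfun.diff_right PY[OF y(1)])
    also have "\<dots> \<le> norm (blinfun_apply K x - y)" by (rule P(4))
    finally show ?thesis using y(2) by (simp add: dist_norm norm_minus_commute)
  qed
  have "norm (P o\<^sub>L K) \<le> \<epsilon>"
  proof (rule norm_blinfun_bound)
    fix x
    show "norm (blinfun_apply (P o\<^sub>L K) x) \<le> \<epsilon> * norm x"
    proof (cases "x = 0")
      case False
      then show ?thesis
        using le[of "(1 / norm x) *\<^sub>R x"] by (simp add: blinfun.scaleR_right field_simps)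
    qed simp
  qed (use \<epsilon> in simp)
  then have "norm (K - F) \<le> \<epsilon>" by (simp add: F_def)
  moreover have "F \<in> bounded_operators"
    using Kb P(1) by (simp add: bounded_operators_iff Fx complex_vector.scale_right_diff_distrib)
  ultimately show ?thesis
    using that[of F Y] Y(1) P(3) fixP by (simp add: Fx)
qed

text \<open>Pulls the finitely many real functionals that define the complement of \<open>S\<close>
  back along \<open>T\<close>; with the identity for \<open>T\<close> it covers the complement
  itself.\<close>

lemma orthogonal_complement_preimage_functionals:
  fixes T :: "'a::complex_inner \<Rightarrow>\<^sub>L 'b::complex_inner"
  assumes "finite S"
  shows "\<exists>\<Phi>::('a \<Rightarrow> real) set. finite \<Phi> \<and> (\<forall>f\<in>\<Phi>. bounded_linear f) \<and>
    {x. blinfun_apply T x \<in> orthogonal_complement S} = {x. \<forall>f\<in>\<Phi>. f x = 0}"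
proof (intro exI[of _ "(\<lambda>y x. inner (blinfun_apply T x) y) ` (S \<union> scaleC \<i> ` S)"] conjI ballI)
  fix f assume "f \<in> (\<lambda>y x. inner (blinfun_apply T x) y) ` (S \<union> scaleC \<i> ` S)"
  then show "bounded_linear f"
    by (auto intro!: bounded_linear_intros)
qed (use assms in \<open>auto simp: orthogonal_complement_altdef\<close>)

text \<open>The criterion applies on a finite-codimensional \<open>R\<close> where \<open>F\<close>
  vanishes and \<open>W\<close> is either isometric or zero, with \<open>\<beta> = \<alpha>\<close>
  or \<open>\<beta> = 0\<close> accordingly.\<close>

lemma AN_operators_partial_isometry_plus_finite_rank:
  fixes W K F :: "'a::chilbert_space \<Rightarrow>\<^sub>L 'b::chilbert_space"
  assumes \<alpha>: "\<alpha> \<ge> 0" and AN: "W \<in> AN_operators" and W: "partial_isometry W"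
    and F: "F \<in> bounded_operators" and Y: "finite Y"
    and FY: "\<And>x. blinfun_apply F x \<in> orthogonal_complement (orthogonal_complement Y)"
    and FK: "\<And>x. blinfun_apply K x \<in> orthogonal_complement Y \<Longrightarrow> blinfun_apply F x = 0"
  shows "\<alpha> *\<^sub>R W + F \<in> AN_operators"
proof -
  let ?N = "null_space W"
  have Wb: "W \<in> bounded_operators" using W by (simp add: partial_isometry_def)
  have B: "\<alpha> *\<^sub>R W + F \<in> bounded_operators"
    using Wb F by (simp add: bounded_operators_iff plus_blinfun.rep_eq scaleR_blinfun.rep_eq
        scaleC_add_right scaleR_scaleC scaleC_scaleC mult.commute)
  from AN_partial_isometry_finite_dimensional[OF AN W]
  obtain U S where U: "U = ?N \<or> U = orthogonal_complement ?N"
    and S: "finite S" "S \<subseteq> U" "U \<inter> orthogonal_complement S \<subseteq> {0}"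
    by (elim exE conjE)
  have "complex_vector.subspace U" "closed U"
    using U Wb by (auto simp: subspace_null_space closed_null_space
        subspace_orthogonal_complement closed_orthogonal_complement)
  then have US: "orthogonal_complement U = orthogonal_complement S"
    using S by (intro orthogonal_complement_finite_dimensional)
  from orthogonal_complement_preimage_functionals[OF S(1), of id_blinfun]
  obtain \<Phi>1 :: "('a \<Rightarrow> real) set" where \<Phi>1: "finite \<Phi>1" "\<forall>f\<in>\<Phi>1. bounded_linear f"
    "{x. blinfun_apply id_blinfun x \<in> orthogonal_complement S} = {x. \<forall>f\<in>\<Phi>1. f x = 0}"
    by (elim exE conjE)
  from orthogonal_complement_preimage_functionals[OF Y, of K]
  obtain \<Phi>2 :: "('a \<Rightarrow> real) set" where \<Phi>2: "finite \<Phi>2" "\<forall>f\<in>\<Phi>2. bounded_linear f"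
    "{x. blinfun_apply K x \<in> orthogonal_complement Y} = {x. \<forall>f\<in>\<Phi>2. f x = 0}"
    by (elim exE conjE)
  from orthogonal_complement_preimage_functionals[OF Y, of W]
  obtain \<Phi>3 :: "('a \<Rightarrow> real) set" where \<Phi>3: "finite \<Phi>3" "\<forall>f\<in>\<Phi>3. bounded_linear f"
    "{x. blinfun_apply W x \<in> orthogonal_complement Y} = {x. \<forall>f\<in>\<Phi>3. f x = 0}"
    by (elim exE conjE)
  \<comment> \<open>The three families have separate tasks: \<open>\<Phi>1\<close> places
    \<open>R\<close> in the complement of \<open>U\<close>, \<open>\<Phi>2\<close> makes
    \<open>F\<close> vanish on \<open>R\<close>, and \<open>\<Phi>3\<close> makes the image of
    \<open>R\<close> under \<open>W\<close> orthogonal to the whole range of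
    \<open>F\<close>.\<close>
  define R where "R = {x. \<forall>f\<in>\<Phi>1 \<union> \<Phi>2 \<union> \<Phi>3. f x = 0}"
  have RU: "l \<in> orthogonal_complement U" if "l \<in> R" for l
    using that \<Phi>1(3) by (auto simp: R_def US)
  have RF: "blinfun_apply F l = 0" if "l \<in> R" for l
    using that \<Phi>2(3) by (intro FK) (auto simp: R_def)
  have RW: "blinfun_apply W l \<in> orthogonal_complement Y" if "l \<in> R" for l
    using that \<Phi>3(3) by (auto simp: R_def)
  have "\<exists>\<beta>\<ge>0. \<forall>l\<in>R. \<forall>x. inner (blinfun_apply (\<alpha> *\<^sub>R W + F) x) (blinfun_apply (\<alpha> *\<^sub>R W + F) l)
      = \<beta>\<^sup>2 * inner x l"
    using U
  proof
    assume U: "U = ?N"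
    have "inner (blinfun_apply (\<alpha> *\<^sub>R W + F) x) (blinfun_apply (\<alpha> *\<^sub>R W + F) l) = \<alpha>\<^sup>2 * inner x l"
      if l: "l \<in> R" for l x
    proof -
      have "inner (blinfun_apply F x) (blinfun_apply W l) = 0"
        using FY[of x] RW[OF l] by (auto simp: orthogonal_complement_def intro: inner_eq_0_if_cinner)
      moreover have "inner (blinfun_apply W x) (blinfun_apply W l) = inner x l"
        using partial_isometry_inner[OF W] RU[OF l] U by simp
      ultimately show ?thesis
        using RF[OF l] by (simp add: plus_blinfun.rep_eq scaleR_blinfun.rep_eq inner_add_left
            power2_eq_square)
    qed
    with \<alpha> show ?thesis by blast
  next
    assume U: "U = orthogonal_complement ?N"
    have "blinfun_apply (\<alpha> *\<^sub>R W + F) l = 0" if l: "l \<in> R" for l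
    proof -
      obtain n m where nm: "n \<in> ?N" "m \<in> orthogonal_complement ?N" "l = n + m"
        using complex_orthogonal_decomposition[OF subspace_null_space[OF Wb] closed_null_space] .
      \<comment> \<open>Here \<open>l\<close> lies in the double complement of the null space, so
        its component \<open>m\<close> is orthogonal to itself and \<open>W\<close> kills
        \<open>l\<close>.\<close>
      have "n + m - n \<in> orthogonal_complement (orthogonal_complement ?N)"
        using RU[OF l] in_double_orthogonal_complement[OF nm(1)]
        unfolding U nm(3) by (rule complex_vector.subspace_diff[OF subspace_orthogonal_complement])
      then have "m = 0" using orthogonal_complement_Int[OF nm(2)] by simp
      then show ?thesis
        using nm RF[OF l] by (simp add: plus_blinfun.rep_eq scaleR_blinfun.rep_eq null_space_def)
    qed
    then show ?thesis by (intro exI[of _ 0]) simp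
  qed
  then obtain \<beta> where "\<beta> \<ge> 0" "\<And>x l. l \<in> R \<Longrightarrow>
      inner (blinfun_apply (\<alpha> *\<^sub>R W + F) x) (blinfun_apply (\<alpha> *\<^sub>R W + F) l) = \<beta>\<^sup>2 * inner x l"
    by blast
  then show ?thesis
    using \<Phi>1 \<Phi>2 \<Phi>3
    by (intro AN_operators_if_scaled_isometry_on_finite_codimension[OF B _ _ R_def]) auto
qed

section \<open>Passage to the closure\<close>

theorem corollary3p6:
  fixes A W K :: "'a::chilbert_space \<Rightarrow>\<^sub>L 'b::chilbert_space"
    and \<alpha> :: real
  assumes "\<alpha> \<ge> 0"
    and "W \<in> AN_operators"
    and "partial_isometry W"
    and "K \<in> compact_operators"
    and "A = \<alpha> *\<^sub>R W + K"
  shows "A \<in> closure AN_operators"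
  unfolding closure_approachable
proof (intro allI impI)
  fix \<epsilon> :: real assume \<epsilon>: "\<epsilon> > 0"
  \<comment> \<open>The approximation bound is not strict but the closure demands a strict one,
    hence the half.\<close>
  then obtain F Y where F: "F \<in> bounded_operators" "finite Y" "norm (K - F) \<le> \<epsilon> / 2"
    "\<And>x. blinfun_apply F x \<in> orthogonal_complement (orthogonal_complement Y)"
    "\<And>x. blinfun_apply K x \<in> orthogonal_complement Y \<Longrightarrow> blinfun_apply F x = 0"
    using compact_operator_finite_rank_approximation[OF assms(4), of "\<epsilon> / 2"] by auto
  have "\<alpha> *\<^sub>R W + F \<in> AN_operators"
    using AN_operators_partial_isometry_plus_finite_rank[OF assms(1-3) F(1,2,4,5)] .
  moreover have "dist (\<alpha> *\<^sub>R W + F) A < \<epsilon>"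
    using F(3) \<epsilon> by (simp add: assms(5) dist_norm norm_minus_commute)
  ultimately show "\<exists>y\<in>AN_operators. dist y A < \<epsilon>" by blast
qed

end
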